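(* Let $F, F', G, G' \colon \mathbf{Set} \to \mathbf{Set}$ be taut functors and let $t \colon F \to F'$ and $u \colon G \to G'$ be taut natural transformations. Then $$\Delta[u \circ t] \cdot \gamma_{G,F} = \gamma_{G',F'} \cdot \bigl((\Delta[u] \circ t) \times \Delta[t]\bigr)$$ as natural transformations $(\Delta[G] \circ F) \times \Delta[F] \to \Delta[G' \circ F']$, where $u \circ t \colon G \circ F \to G' \circ F'$ and $\Delta[u] \circ t \colon \Delta[G]\circ F \to \Delta[G'] \circ F'$ denote horizontal composites.
   Context: A functor is taut if it preserves inverse image diagrams, i.e. pullback squares in which one leg is a monomorphism (pullbacks of a monomorphism along an arbitrary morphism). A natural transformation $t \colon F \to G$ is taut if for every monomorphism $m \colon A_0 \to A$ the naturality square of $t$ at $m$ is a pullback. Taut functors preserve monomorphisms, and composites of taut functors are taut; horizontal composites of taut transformations between taut functors are taut. For a taut functor $F \colon \mathbf{Set} \to \mathbf{Set}$ let $j_X \colon X \to X+1$ be the coproduct injection. The difference functor of $F$ is $\Delta[F](X) = F(X+1) \setminus \mathrm{Im}\, F(j_X)$; for $f \colon X \to Y$, $\Delta[F](f)$ is the restriction of $F(f+1)$ (which does restrict, because $F$ is taut). It is a taut functor. For a taut transformation $t \colon F \to G$ between taut functors, $\Delta[t] \colon \Delta[F] \to \Delta[G]$ is the taut transformation whose component at $X$ is the restriction of $t(X+1)$. Chain rule transformation: for taut $F, G$, the natural transformation $\gamma_{G,F} \colon (\Delta[G]\circ F) \times \Delta[F] \to \Delta[G \circ F]$ is given, for $x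 \in \Delta[F](A)$ and $y \in \Delta[G](F(A)) \subseteq G(F(A)+1)$, by $\gamma_{G,F}(A)(y,x) = G(\phi_x)(y)$, where $\phi_x = [F(j_A), x] \colon F(A)+1 \to F(A+1)$. *)

theory Defs
  imports "HOL-Library.FuncSet"
begin

section \<open>The category of sets\<close>

text \<open>
  HOL has no type of all sets on which a functor \<open>Set \<Rightarrow> Set\<close> could be defined, so the category
  \<open>Set\<close> is taken relative to a universe: a type \<open>'a\<close> of potential elements, together with the
  collection of those \<open>A :: 'a set\<close> that are sets (\<open>small\<close>) rather than proper classes. The objects
  are the small sets, and the morphisms are all functions between them. Only the closure
  properties needed for the constructions \<open>X + 1\<close>, \<open>X \<times> Y\<close> and subsets are required. For
  instance, if \<open>'a\<close> carries a full (second-order) model of ZFC, such as a Grothendieck universe, and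
  the small sets are the extensions of the elements of \<open>'a\<close>, this is the usual category of sets.

  The encodings realise \<open>X + 1\<close> and \<open>X \<times> Y\<close> as sets of elements of the same type \<open>'a\<close>.
\<close>

class set_universe =
  fixes small :: "'a set \<Rightarrow> bool"
    and encode_option :: "'a option \<Rightarrow> 'a"
    and encode_pair :: "'a \<times> 'a \<Rightarrow> 'a"
  assumes inj_encode_option: "inj encode_option"
    and inj_encode_pair: "inj encode_pair"
    and small_empty: "small {}"
    and small_subset: "small A \<Longrightarrow> B \<subseteq> A \<Longrightarrow> small B"
    and small_option: "small A \<Longrightarrow> small (encode_option ` insert None (Some ` A))"
    and small_times: "small A \<Longrightarrow> small B \<Longrightarrow> small (encode_pair ` (A \<times> B))"

text \<open>
  A morphism \<open>A \<rightarrow> B\<close> is a function from \<open>A\<close> to \<open>B\<close> that is \<open>undefined\<close> outside \<open>A\<close>, so that equality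
  of parallel morphisms is equality in HOL. The composite of \<open>f : A \<rightarrow> B\<close> and \<open>g : B \<rightarrow> C\<close> is
  \<open>compose A g f\<close>, and the identity of \<open>A\<close> is \<open>restrict id A\<close>.
\<close>

definition hom :: "'v::set_universe set \<Rightarrow> 'v set \<Rightarrow> ('v \<Rightarrow> 'v) set" where
  "hom A B = {f. small A \<and> small B \<and> f \<in> A \<rightarrow>\<^sub>E B}"

definition monic :: "'v::set_universe set \<Rightarrow> 'v set \<Rightarrow> ('v \<Rightarrow> 'v) \<Rightarrow> bool" where
  "monic A B m \<longleftrightarrow> m \<in> hom A B \<and>
     (\<forall>T. \<forall>h \<in> hom T A. \<forall>k \<in> hom T A. compose T m h = compose T m k \<longrightarrow> h = k)"

text \<open>
  \<open>pullback P B C A p q f g\<close> says that the following square commutes and is a pullback: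
  \<open>p : P \<rightarrow> B\<close> and \<open>q : P \<rightarrow> C\<close> over \<open>f : B \<rightarrow> A\<close> and \<open>g : C \<rightarrow> A\<close>.
\<close>

definition pullback ::
  "'v::set_universe set \<Rightarrow> 'v set \<Rightarrow> 'v set \<Rightarrow> 'v set \<Rightarrow>
   ('v \<Rightarrow> 'v) \<Rightarrow> ('v \<Rightarrow> 'v) \<Rightarrow> ('v \<Rightarrow> 'v) \<Rightarrow> ('v \<Rightarrow> 'v) \<Rightarrow> bool" where
  "pullback P B C A p q f g \<longleftrightarrow>
     p \<in> hom P B \<and> q \<in> hom P C \<and> f \<in> hom B A \<and> g \<in> hom C A \<and>
     compose P f p = compose P g q \<and>
     (\<forall>T. \<forall>h \<in> hom T B. \<forall>k \<in> hom T C. compose T f h = compose T g k \<longrightarrow>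
        (\<exists>!r. r \<in> hom T P \<and> compose T p r = h \<and> compose T q r = k))"

definition times :: "'v::set_universe set \<Rightarrow> 'v set \<Rightarrow> 'v set" where
  "times A B = encode_pair ` (A \<times> B)"

abbreviation decode_pair :: "'v::set_universe \<Rightarrow> 'v \<times> 'v" where
  "decode_pair \<equiv> inv encode_pair"

text \<open>The morphism \<open>f \<times> g : A \<times> B \<rightarrow> C \<times> D\<close>.\<close>

definition times_map ::
  "'v::set_universe set \<Rightarrow> 'v set \<Rightarrow> ('v \<Rightarrow> 'v) \<Rightarrow> ('v \<Rightarrow> 'v) \<Rightarrow> 'v \<Rightarrow> 'v" where
  "times_map A B f g = (\<lambda>z \<in> times A B. encode_pair (map_prod f g (decode_pair z)))"

definition plus_one :: "'v::set_universe set \<Rightarrow> 'v set" where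
  "plus_one X = encode_option ` insert None (Some ` X)"

abbreviation decode_option :: "'v::set_universe \<Rightarrow> 'v option" where
  "decode_option \<equiv> inv encode_option"

text \<open>The coproduct injection \<open>j\<^sub>X : X \<rightarrow> X + 1\<close>.\<close>

definition inj_one :: "'v::set_universe set \<Rightarrow> 'v \<Rightarrow> 'v" where
  "inj_one X = (\<lambda>w \<in> X. encode_option (Some w))"

text \<open>The morphism \<open>f + 1 : X + 1 \<rightarrow> Y + 1\<close>.\<close>

definition plus_one_map :: "'v::set_universe set \<Rightarrow> ('v \<Rightarrow> 'v) \<Rightarrow> 'v \<Rightarrow> 'v" where
  "plus_one_map X f = (\<lambda>w \<in> plus_one X. encode_option (map_option f (decode_option w)))"

text \<open>The morphism \<open>[g, x] : X + 1 \<rightarrow> Y\<close> induced by \<open>g : X \<rightarrow> Y\<close> and an element \<open>x\<close> of \<open>Y\<close>.\<close>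

definition copair :: "'v::set_universe set \<Rightarrow> ('v \<Rightarrow> 'v) \<Rightarrow> 'v \<Rightarrow> 'v \<Rightarrow> 'v" where
  "copair X g x = (\<lambda>w \<in> plus_one X. case decode_option w of None \<Rightarrow> x | Some v \<Rightarrow> g v)"


section \<open>Functors and natural transformations\<close>

text \<open>
  Since a function does not determine its codomain, the action on morphisms takes domain and
  codomain as arguments: \<open>Map F A B f\<close> is the image of \<open>f : A \<rightarrow> B\<close>. The values of
  \<open>Ob\<close>, \<open>Map\<close> and \<open>Comp\<close> at arguments that are not small sets (or not morphisms) are irrelevant.
\<close>

record 'v endofunctor =
  Ob :: "'v set \<Rightarrow> 'v set"
  Map :: "'v set \<Rightarrow> 'v set \<Rightarrow> ('v \<Rightarrow> 'v) \<Rightarrow> 'v \<Rightarrow> 'v"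

record 'v transformation =
  Dom :: "'v endofunctor"
  Cod :: "'v endofunctor"
  Comp :: "'v set \<Rightarrow> 'v \<Rightarrow> 'v"

locale set_functor =
  fixes F :: "'v::set_universe endofunctor"
  assumes small_Ob: "small A \<Longrightarrow> small (Ob F A)"
    and Map_hom: "f \<in> hom A B \<Longrightarrow> Map F A B f \<in> hom (Ob F A) (Ob F B)"
    and Map_id: "small A \<Longrightarrow> Map F A A (restrict id A) = restrict id (Ob F A)"
    and Map_compose: "f \<in> hom A B \<Longrightarrow> g \<in> hom B C \<Longrightarrow>
      Map F A C (compose A g f) = compose (Ob F A) (Map F B C g) (Map F A B f)"

locale taut_functor = set_functor +
  assumes preserves_inverse_images:
    "pullback P B C A p q f m \<Longrightarrow> monic C A m \<Longrightarrow>
     pullback (Ob F P) (Ob F B) (Ob F C) (Ob F A)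
       (Map F P B p) (Map F P C q) (Map F B A f) (Map F C A m)"

locale nat_trans =
  dom: set_functor F + cod: set_functor G
  for F G :: "'v::set_universe endofunctor" +
  fixes t :: "'v transformation"
  assumes Dom_eq: "Dom t = F"
    and Cod_eq: "Cod t = G"
    and Comp_hom: "small A \<Longrightarrow> Comp t A \<in> hom (Ob F A) (Ob G A)"
    and naturality: "f \<in> hom A B \<Longrightarrow>
      compose (Ob F A) (Comp t B) (Map F A B f) = compose (Ob F A) (Map G A B f) (Comp t A)"

locale taut_nat_trans = nat_trans +
  assumes naturality_pullback: "monic A\<^sub>0 A m \<Longrightarrow>
    pullback (Ob F A\<^sub>0) (Ob G A\<^sub>0) (Ob F A) (Ob G A)
      (Comp t A\<^sub>0) (Map F A\<^sub>0 A m) (Map G A\<^sub>0 A m) (Comp t A)"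

text \<open>Equality of \<open>s\<close> and \<open>t\<close> as natural transformations from \<open>F\<close> to \<open>G\<close>.\<close>

definition nat_trans_eq ::
  "'v::set_universe endofunctor \<Rightarrow> 'v endofunctor \<Rightarrow>
   'v transformation \<Rightarrow> 'v transformation \<Rightarrow> bool" where
  "nat_trans_eq F G s t \<longleftrightarrow>
     nat_trans F G s \<and> nat_trans F G t \<and> (\<forall>A. small A \<longrightarrow> Comp s A = Comp t A)"

definition functor_comp ::
  "'v::set_universe endofunctor \<Rightarrow> 'v endofunctor \<Rightarrow> 'v endofunctor"  (infixr "\<odot>" 75) where
  "G \<odot> F = \<lparr>Ob = (\<lambda>A. Ob G (Ob F A)),
            Map = (\<lambda>A B f. Map G (Ob F A) (Ob F B) (Map F A B f))\<rparr>"

definition functor_times ::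
  "'v::set_universe endofunctor \<Rightarrow> 'v endofunctor \<Rightarrow> 'v endofunctor"  (infixr "\<otimes>" 70) where
  "F \<otimes> G = \<lparr>Ob = (\<lambda>A. times (Ob F A) (Ob G A)),
            Map = (\<lambda>A B f. times_map (Ob F A) (Ob G A) (Map F A B f) (Map G A B f))\<rparr>"

text \<open>The vertical composite \<open>s \<cdot> t\<close>.\<close>

definition vertical_comp ::
  "'v::set_universe transformation \<Rightarrow> 'v transformation \<Rightarrow> 'v transformation"
  (infixr "\<bullet>" 60) where
  "s \<bullet> t = \<lparr>Dom = Dom t, Cod = Cod s,
            Comp = (\<lambda>A. compose (Ob (Dom t) A) (Comp s A) (Comp t A))\<rparr>"

text \<open>
  The horizontal composite \<open>u \<circ> t : G \<circ> F \<rightarrow> G' \<circ> F'\<close> of \<open>t : F \<rightarrow> F'\<close> and \<open>u : G \<rightarrow> G'\<close>, with component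
  \<open>u(F'(A)) \<cdot> G(t(A))\<close> at \<open>A\<close> (by naturality of \<open>u\<close>, also \<open>G'(t(A)) \<cdot> u(F(A))\<close>).
\<close>

definition horizontal_comp ::
  "'v::set_universe transformation \<Rightarrow> 'v transformation \<Rightarrow> 'v transformation"
  (infixr "\<star>" 75) where
  "u \<star> t = \<lparr>Dom = Dom u \<odot> Dom t, Cod = Cod u \<odot> Cod t,
            Comp = (\<lambda>A. compose (Ob (Dom u \<odot> Dom t) A)
                      (Comp u (Ob (Cod t) A))
                      (Map (Dom u) (Ob (Dom t) A) (Ob (Cod t) A) (Comp t A)))\<rparr>"

definition trans_times ::
  "'v::set_universe transformation \<Rightarrow> 'v transformation \<Rightarrow> 'v transformation"
  (infixr "\<boxtimes>" 70) where
  "s \<boxtimes> t = \<lparr>Dom = Dom s \<otimes> Dom t, Cod = Cod s \<otimes> Cod t,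
            Comp = (\<lambda>A. times_map (Ob (Dom s) A) (Ob (Dom t) A) (Comp s A) (Comp t A))\<rparr>"


section \<open>The difference operator and the chain rule transformation\<close>

definition difference :: "'v::set_universe endofunctor \<Rightarrow> 'v endofunctor"  ("\<Delta>") where
  "\<Delta> F = \<lparr>Ob = (\<lambda>X. Ob F (plus_one X) - Map F X (plus_one X) (inj_one X) ` Ob F X),
          Map = (\<lambda>X Y f. restrict (Map F (plus_one X) (plus_one Y) (plus_one_map X f))
                   (Ob F (plus_one X) - Map F X (plus_one X) (inj_one X) ` Ob F X))\<rparr>"

definition difference_trans :: "'v::set_universe transformation \<Rightarrow> 'v transformation"
  ("\<Delta>\<^sub>N") where
  "\<Delta>\<^sub>N t = \<lparr>Dom = \<Delta> (Dom t), Cod = \<Delta> (Cod t),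
           Comp = (\<lambda>X. restrict (Comp t (plus_one X)) (Ob (\<Delta> (Dom t)) X))\<rparr>"

text \<open>The morphism \<open>\<phi>\<^sub>x = [F(j\<^sub>A), x] : F(A) + 1 \<rightarrow> F(A + 1)\<close> for \<open>x\<close> in \<open>\<Delta>[F](A)\<close>.\<close>

definition \<phi> :: "'v::set_universe endofunctor \<Rightarrow> 'v set \<Rightarrow> 'v \<Rightarrow> 'v \<Rightarrow> 'v" where
  "\<phi> F A x = copair (Ob F A) (Map F A (plus_one A) (inj_one A)) x"

definition \<gamma> ::
  "'v::set_universe endofunctor \<Rightarrow> 'v endofunctor \<Rightarrow> 'v transformation" where
  "\<gamma> G F = \<lparr>Dom = (\<Delta> G \<odot> F) \<otimes> \<Delta> F, Cod = \<Delta> (G \<odot> F),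
            Comp = (\<lambda>A. \<lambda>z \<in> Ob ((\<Delta> G \<odot> F) \<otimes> \<Delta> F) A. case decode_pair z of (y, x) \<Rightarrow>
                      Map G (plus_one (Ob F A)) (Ob F (plus_one A)) (\<phi> F A x) y)\<rparr>"

end

theory Submission
  imports Defs
begin

text \<open>
  Taut functors preserve the inverse images that define the difference functor: \<open>j\<^sub>X\<close> is the inverse
  image of \<open>j\<^sub>Y\<close> along \<open>f + 1\<close>, and, for \<open>x\<close> outside the image of \<open>F(j\<^sub>A)\<close>, \<open>j\<^sub>F\<^sub>(\<^sub>A\<^sub>)\<close> is the inverse
  image of \<open>F(j\<^sub>A)\<close> along \<open>\<phi>\<^sub>x\<close>. Hence all maps involved restrict to complements. The equation itself
  follows from \<open>t(A + 1) \<cdot> \<phi>\<^sub>x = \<phi>\<^sub>x\<^sub>' \<cdot> (t(A) + 1)\<close> with \<open>x' = t(A + 1)(x)\<close>, together with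
  naturality of \<open>u\<close> at \<open>\<phi>\<^sub>x\<^sub>'\<close>.
\<close>

section \<open>Sets and functions in the universe\<close>

lemma homI:
  assumes "small A" "small B" "\<And>x. x \<in> A \<Longrightarrow> f x \<in> B" "f \<in> extensional A"
  shows "f \<in> hom A B"
  using assms by (auto simp: hom_def PiE_def)

lemma hom_apply: "f \<in> hom A B \<Longrightarrow> x \<in> A \<Longrightarrow> f x \<in> B"
  by (auto simp: hom_def)

lemma hom_small: "f \<in> hom A B \<Longrightarrow> small A" "f \<in> hom A B \<Longrightarrow> small B"
  by (auto simp: hom_def)

lemma hom_extensional: "f \<in> hom A B \<Longrightarrow> f \<in> extensional A"
  by (auto simp: hom_def PiE_def)

lemma hom_eqI: "f \<in> hom A B \<Longrightarrow> g \<in> hom A C \<Longrightarrow> (\<And>x. x \<in> A \<Longrightarrow> f x = g x) \<Longrightarrow> f = g"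
  by (meson extensionalityI hom_extensional)

lemma compose_eqI: "(\<And>x. x \<in> A \<Longrightarrow> g (f x) = k (h x)) \<Longrightarrow> compose A g f = compose A k h"
  by (auto simp: compose_def fun_eq_iff)

lemma compose_eqD: "compose A g f = compose A k h \<Longrightarrow> x \<in> A \<Longrightarrow> g (f x) = k (h x)"
  by (metis compose_eq)

lemma compose_hom: "f \<in> hom A B \<Longrightarrow> g \<in> hom B C \<Longrightarrow> compose A g f \<in> hom A C"
  by (intro homI) (auto simp: compose_eq hom_apply hom_small)

lemma id_hom: "small A \<Longrightarrow> restrict id A \<in> hom A A"
  by (intro homI) auto

section \<open>Monomorphisms and pullbacks in terms of elements\<close>

lemma monic_iff: "monic A B m \<longleftrightarrow> m \<in> hom A B \<and> inj_on m A"
proof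
  assume m: "monic A B m"
  then have hom: "m \<in> hom A B" by (simp add: monic_def)
  have "x = y" if x: "x \<in> A" and y: "y \<in> A" and eq: "m x = m y" for x y
  proof -
    \<comment> \<open>The test object is \<open>{x}\<close>, small as a subset of \<open>A\<close>.
      The two constant maps from it with values \<open>x\<close> and \<open>y\<close> become equal
      after \<open>m\<close>, so cancelling \<open>m\<close> identifies the two points.\<close>
    have sm: "small {x}"
      using small_subset[OF hom_small(1)[OF hom]] x by simp
    have h: "(\<lambda>s\<in>{x}. x) \<in> hom {x} A" "(\<lambda>s\<in>{x}. y) \<in> hom {x} A"
      using x y sm hom_small(1)[OF hom] by (auto intro!: homI)
    have "compose {x} m (\<lambda>s\<in>{x}. x) = compose {x} m (\<lambda>s\<in>{x}. y)"
      by (rule compose_eqI) (simp add: eq)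
    then have "(\<lambda>s\<in>{x}. x) = (\<lambda>s\<in>{x}. y)"
      using m h unfolding monic_def by blast
    from fun_cong[OF this, of x] show ?thesis by simp
  qed
  with hom show "m \<in> hom A B \<and> inj_on m A" by (auto intro: inj_onI)
next
  assume m: "m \<in> hom A B \<and> inj_on m A"
  show "monic A B m"
    unfolding monic_def
  proof (intro conjI allI ballI impI)
    fix T h k
    assume h: "h \<in> hom T A" and k: "k \<in> hom T A" and eq: "compose T m h = compose T m k"
    show "h = k"
      using m by (intro hom_eqI[OF h k])
        (metis compose_eqD[OF eq] inj_onD hom_apply[OF h] hom_apply[OF k])
  qed (use m in simp)
qed

text \<open>A mediating map is determined pointwise, so unique existence of an element over each
  compatible pair is enough.\<close>

lemma pullbackI:
  assumes p: "p \<in> hom P B" and q: "q \<in> hom P C" and f: "f \<in> hom B A" and g: "g \<in> hom C A"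
    and comm: "\<And>a. a \<in> P \<Longrightarrow> f (p a) = g (q a)"
    and univ: "\<And>b c. b \<in> B \<Longrightarrow> c \<in> C \<Longrightarrow> f b = g c \<Longrightarrow> \<exists>!a. a \<in> P \<and> p a = b \<and> q a = c"
  shows "pullback P B C A p q f g"
  unfolding pullback_def
proof (intro conjI allI ballI impI p q f g)
  show "compose P f p = compose P g q"
    by (rule compose_eqI) (rule comm)
  fix T h k
  assume h: "h \<in> hom T B" and k: "k \<in> hom T C" and eq: "compose T f h = compose T g k"
  \<comment> \<open>The unique elements are collected by \<open>THE\<close>; restricting to
    \<open>T\<close> makes the result extensional and hence a morphism.\<close>
  define r where "r = (\<lambda>s\<in>T. THE a. a \<in> P \<and> p a = h s \<and> q a = k s)"
  have ex1: "\<exists>!a. a \<in> P \<and> p a = h s \<and> q a = k s" if "s \<in> T" for s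
    using that by (intro univ hom_apply[OF h] hom_apply[OF k] compose_eqD[OF eq])
  have r: "r s \<in> P \<and> p (r s) = h s \<and> q (r s) = k s" if "s \<in> T" for s
    using theI'[OF ex1[OF that]] that by (simp add: r_def)
  have r_hom: "r \<in> hom T P"
    using hom_small(1)[OF h] hom_small(1)[OF p] r by (intro homI) (auto simp: r_def)
  show "\<exists>!r. r \<in> hom T P \<and> compose T p r = h \<and> compose T q r = k"
  proof (intro ex1I conjI)
    show "compose T p r = h"
      by (rule hom_eqI[OF compose_hom[OF r_hom p] h]) (simp add: compose_eq r)
    show "compose T q r = k"
      by (rule hom_eqI[OF compose_hom[OF r_hom q] k]) (simp add: compose_eq r)
    fix r'
    assume r': "r' \<in> hom T P \<and> compose T p r' = h \<and> compose T q r' = k"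
    then have r'_hom: "r' \<in> hom T P" by simp
    show "r' = r"
    proof (rule hom_eqI[OF r'_hom r_hom])
      fix s assume s: "s \<in> T"
      have "p (r' s) = h s" "q (r' s) = k s"
        using r' s by (auto simp: compose_eq)
      with ex1[OF s] r[OF s] hom_apply[OF r'_hom s] show "r' s = r s" by blast
    qed
  qed (rule r_hom)
qed

lemma pullback_homD:
  assumes "pullback P B C A p q f g"
  shows "p \<in> hom P B" "q \<in> hom P C" "f \<in> hom B A" "g \<in> hom C A"
  using assms by (auto simp: pullback_def)

text \<open>The universal property is evaluated on the one-element set \<open>{b}\<close>, with
  constant maps to \<open>b\<close> and \<open>c\<close>. This is how the pullbacks preserved by
  taut functors and given by taut transformations are exploited.\<close>

lemma pullback_lift:
  assumes pb: "pullback P B C A p q f g" and b: "b \<in> B" and c: "c \<in> C" and eq: "f b = g c"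
  obtains a where "a \<in> P" "p a = b" "q a = c"
proof -
  have small: "small B" "small C"
    using pullback_homD[OF pb] by (auto dest: hom_small)
  have sb: "small {b}"
    using small_subset[OF small(1)] b by simp
  have h: "(\<lambda>s\<in>{b}. b) \<in> hom {b} B" and k: "(\<lambda>s\<in>{b}. c) \<in> hom {b} C"
    using b c sb small by (auto intro!: homI)
  have "compose {b} f (\<lambda>s\<in>{b}. b) = compose {b} g (\<lambda>s\<in>{b}. c)"
    by (rule compose_eqI) (simp add: eq)
  with pb h k obtain r where r: "r \<in> hom {b} P"
    "compose {b} p r = (\<lambda>s\<in>{b}. b)" "compose {b} q r = (\<lambda>s\<in>{b}. c)"
    unfolding pullback_def by blast
  show ?thesis
    using fun_cong[OF r(2), of b] fun_cong[OF r(3), of b] hom_apply[OF r(1), of b]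
    by (intro that[of "r b"]) (auto simp: compose_eq)
qed

text \<open>Injectivity of \<open>p\<close> supplies uniqueness, leaving only existence to check.
  All squares verified by elements below have a monic first leg.\<close>

lemma pullback_monicI:
  assumes "monic P B p" "q \<in> hom P C" "f \<in> hom B A" "g \<in> hom C A"
    and "\<And>a. a \<in> P \<Longrightarrow> f (p a) = g (q a)"
    and "\<And>b c. b \<in> B \<Longrightarrow> c \<in> C \<Longrightarrow> f b = g c \<Longrightarrow> \<exists>a. a \<in> P \<and> p a = b \<and> q a = c"
  shows "pullback P B C A p q f g"
  using assms by (intro pullbackI) (auto simp: monic_iff dest: inj_onD)

text \<open>Reconciles two conventions: the monomorphism comes last in
  \<open>preserves_inverse_images\<close>, but before the component of \<open>t\<close> at the
  codomain in \<open>naturality_pullback\<close>.\<close>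

lemma pullback_sym:
  assumes pb: "pullback P B C A p q f g"
  shows "pullback P C B A q p g f"
  unfolding pullback_def
proof (intro conjI allI ballI impI)
  fix T h k
  assume "h \<in> hom T C" "k \<in> hom T B" "compose T g h = compose T f k"
  with pb have "\<exists>!r. r \<in> hom T P \<and> compose T p r = k \<and> compose T q r = h"
    unfolding pullback_def by metis
  then show "\<exists>!r. r \<in> hom T P \<and> compose T q r = h \<and> compose T p r = k"
    by (simp add: conj_commute conj_left_commute)
qed (use pb in \<open>auto simp: pullback_def\<close>)

section \<open>Elements and morphisms of the encoded sets \<open>plus_one X\<close> and
  \<open>times X Y\<close>\<close>

lemma decode_encode_option [simp]: "decode_option (encode_option w) = w"
  by (simp add: inj_encode_option)

lemma decode_encode_pair [simp]: "decode_pair (encode_pair z) = z"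
  by (simp add: inj_encode_pair)

lemma encode_option_eq_iff [simp]: "encode_option v = encode_option w \<longleftrightarrow> v = w"
  by (simp add: inj_encode_option inj_eq)

lemma small_plus_one: "small X \<Longrightarrow> small (plus_one X)"
  by (simp only: plus_one_def small_option)

lemma small_times_set: "small X \<Longrightarrow> small Y \<Longrightarrow> small (times X Y)"
  by (simp only: times_def small_times)

lemma plus_one_cases [consumes 1, case_names None Some]:
  assumes "w \<in> plus_one X"
  obtains "w = encode_option None" | v where "v \<in> X" "w = encode_option (Some v)"
  using assms by (auto simp: plus_one_def)

lemma mem_plus_one [simp]:
  "encode_option None \<in> plus_one X"
  "encode_option (Some v) \<in> plus_one X \<longleftrightarrow> v \<in> X"
  by (auto simp: plus_one_def)

lemma mem_times [simp]: "encode_pair (y, x) \<in> times A B \<longleftrightarrow> y \<in> A \<and> x \<in> B"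
  by (auto simp: times_def inj_eq[OF inj_encode_pair])

lemma times_cases:
  assumes "z \<in> times A B"
  obtains y x where "y \<in> A" "x \<in> B" "z = encode_pair (y, x)"
  using assms by (auto simp: times_def)

lemma times_map_encode_pair [simp]:
  "y \<in> A \<Longrightarrow> x \<in> B \<Longrightarrow> times_map A B f g (encode_pair (y, x)) = encode_pair (f y, g x)"
  by (simp add: times_map_def)

lemma times_map_hom:
  assumes "f \<in> hom A C" "g \<in> hom B D"
  shows "times_map A B f g \<in> hom (times A B) (times C D)"
  using assms
  by (intro homI) (auto simp: small_times_set hom_small hom_apply times_map_def elim!: times_cases)

lemma inj_one_apply [simp]: "v \<in> X \<Longrightarrow> inj_one X v = encode_option (Some v)"
  by (simp add: inj_one_def)

lemma inj_one_monic: "small X \<Longrightarrow> monic X (plus_one X) (inj_one X)"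
  unfolding monic_iff by (auto intro!: homI inj_onI simp: small_plus_one inj_one_def)

lemma inj_one_hom: "small X \<Longrightarrow> inj_one X \<in> hom X (plus_one X)"
  using inj_one_monic monic_iff by blast

lemma plus_one_map_apply [simp]:
  "plus_one_map X f (encode_option None) = encode_option None"
  "v \<in> X \<Longrightarrow> plus_one_map X f (encode_option (Some v)) = encode_option (Some (f v))"
  by (auto simp: plus_one_map_def)

lemma plus_one_map_hom:
  assumes "f \<in> hom X Y"
  shows "plus_one_map X f \<in> hom (plus_one X) (plus_one Y)"
  using assms
  by (intro homI)
    (auto simp: small_plus_one hom_small hom_apply plus_one_map_def elim!: plus_one_cases)

lemma copair_apply [simp]:
  "copair X g x (encode_option None) = x"
  "v \<in> X \<Longrightarrow> copair X g x (encode_option (Some v)) = g v"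
  by (auto simp: copair_def)

lemma copair_hom:
  assumes "g \<in> hom X Y" "x \<in> Y"
  shows "copair X g x \<in> hom (plus_one X) Y"
  using assms
  by (intro homI) (auto simp: small_plus_one hom_small hom_apply copair_def elim!: plus_one_cases)

text \<open>Both composites send the added point to \<open>k x\<close>, and on \<open>X\<close> they
  agree by assumption. With \<open>k\<close> taken as \<open>F(f + 1)\<close> or as a component of
  \<open>t\<close>, this gives the two commutation rules for \<open>\<phi>\<close>.\<close>

lemma copair_plus_one_map:
  assumes "h \<in> hom X Y" "\<And>v. v \<in> X \<Longrightarrow> k (g v) = g' (h v)"
  shows "compose (plus_one X) (copair Y g' (k x)) (plus_one_map X h) =
         compose (plus_one X) k (copair X g x)"
  using assms by (intro compose_eqI) (auto simp: hom_apply elim!: plus_one_cases)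

lemma plus_one_map_id:
  assumes "small X"
  shows "plus_one_map X (restrict id X) = restrict id (plus_one X)"
  using assms by (intro hom_eqI[OF plus_one_map_hom id_hom])
    (auto intro: id_hom small_plus_one elim!: plus_one_cases)

lemma plus_one_map_compose:
  assumes "f \<in> hom X Y" "g \<in> hom Y Z"
  shows "plus_one_map X (compose X g f) =
         compose (plus_one X) (plus_one_map Y g) (plus_one_map X f)"
  using assms by (intro hom_eqI[OF plus_one_map_hom compose_hom])
    (auto intro: compose_hom plus_one_map_hom simp: compose_eq hom_apply elim!: plus_one_cases)

text \<open>Since \<open>f + 1\<close> preserves the added point, which is not in the image of
  \<open>inj_one Y\<close>, only elements coming from \<open>X\<close> are mapped into that
  image.\<close>

lemma pullback_inj_one:
  assumes f: "f \<in> hom X Y"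
  shows "pullback X (plus_one X) Y (plus_one Y) (inj_one X) f (plus_one_map X f) (inj_one Y)"
proof (rule pullback_monicI)
  show "monic X (plus_one X) (inj_one X)" "inj_one Y \<in> hom Y (plus_one Y)"
    using f by (auto intro: inj_one_monic inj_one_hom hom_small)
  show "plus_one_map X f \<in> hom (plus_one X) (plus_one Y)" "f \<in> hom X Y"
    using f by (auto intro: plus_one_map_hom)
qed (use f in \<open>auto simp: hom_apply elim!: plus_one_cases\<close>)

text \<open>The added point goes to \<open>x\<close>, outside the image of \<open>m\<close>, so a
  point of \<open>plus_one X\<close> with value \<open>m c\<close> comes from \<open>X\<close>; by
  injectivity of \<open>m\<close> it comes from \<open>c\<close>.\<close>

lemma pullback_copair:
  assumes m: "monic X Y m" and x: "x \<in> Y" "x \<notin> m ` X"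
  shows "pullback X (plus_one X) X Y (inj_one X) (restrict id X) (copair X m x) m"
proof (rule pullback_monicI)
  have hom: "m \<in> hom X Y" and inj: "inj_on m X"
    using m by (auto simp: monic_iff)
  show "monic X (plus_one X) (inj_one X)" "restrict id X \<in> hom X X"
    using hom by (auto intro: inj_one_monic id_hom hom_small)
  show "copair X m x \<in> hom (plus_one X) Y" "m \<in> hom X Y"
    using hom x by (auto intro: copair_hom)
  show "\<exists>a. a \<in> X \<and> inj_one X a = b \<and> restrict id X a = c"
    if "b \<in> plus_one X" "c \<in> X" "copair X m x b = m c" for b c
    using that x inj by (auto simp: inj_on_eq_iff elim!: plus_one_cases)
qed auto


section \<open>Functors and natural transformations\<close>

context set_functor
begin

lemma Map_apply: "f \<in> hom A B \<Longrightarrow> x \<in> Ob F A \<Longrightarrow> Map F A B f x \<in> Ob F B"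
  by (rule hom_apply[OF Map_hom])

lemma Map_compose_apply:
  assumes "f \<in> hom A B" "g \<in> hom B C" "x \<in> Ob F A"
  shows "Map F A C (compose A g f) x = Map F B C g (Map F A B f x)"
  using assms by (simp add: Map_compose compose_eq)

text \<open>Functoriality on a commuting square, at a single element: the form in which the squares
  for \<open>t\<close> and \<open>\<phi>\<close> are passed through a functor.\<close>

lemma Map_square:
  assumes "f \<in> hom A B" "g \<in> hom B D" "h \<in> hom A C" "k \<in> hom C D" "x \<in> Ob F A"
    and "compose A g f = compose A k h"
  shows "Map F B D g (Map F A B f x) = Map F C D k (Map F A C h x)"
  using assms by (metis Map_compose_apply)

end

text \<open>A map is monic exactly when two identities form its kernel pair. That square is an
  inverse image of the monomorphism along itself, so a taut functor preserves it.\<close>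

lemma (in taut_functor) Map_monic:
  assumes m: "monic A B m"
  shows "monic (Ob F A) (Ob F B) (Map F A B m)"
proof -
  have hom: "m \<in> hom A B" and inj: "inj_on m A"
    using m by (auto simp: monic_iff)
  note idA = id_hom[OF hom_small(1)[OF hom]]
  have "pullback A A A B (restrict id A) (restrict id A) m m"
    using idA hom inj by (intro pullback_monicI) (auto simp: monic_iff inj_on_def)
  then have "pullback (Ob F A) (Ob F A) (Ob F A) (Ob F B)
      (Map F A A (restrict id A)) (Map F A A (restrict id A)) (Map F A B m) (Map F A B m)"
    by (rule preserves_inverse_images[OF _ m])
  note pb = this[unfolded Map_id[OF hom_small(1)[OF hom]]]
  have "inj_on (Map F A B m) (Ob F A)"
    by (rule inj_onI) (erule (2) pullback_lift[OF pb], auto)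
  then show ?thesis
    using Map_hom[OF hom] by (simp add: monic_iff)
qed

lemma (in nat_trans) Comp_apply: "small A \<Longrightarrow> x \<in> Ob F A \<Longrightarrow> Comp t A x \<in> Ob G A"
  by (rule hom_apply[OF Comp_hom])

lemma (in nat_trans) naturality_apply:
  "f \<in> hom A B \<Longrightarrow> x \<in> Ob F A \<Longrightarrow> Comp t B (Map F A B f x) = Map G A B f (Comp t A x)"
  by (rule compose_eqD[OF naturality])

section \<open>Composites and products of functors\<close>

lemma functor_comp_simps [simp]:
  "Ob (G \<odot> F) A = Ob G (Ob F A)"
  "Map (G \<odot> F) A B f = Map G (Ob F A) (Ob F B) (Map F A B f)"
  by (simp_all add: functor_comp_def)

lemma functor_times_simps [simp]:
  "Ob (F \<otimes> G) A = times (Ob F A) (Ob G A)"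
  "Map (F \<otimes> G) A B f = times_map (Ob F A) (Ob G A) (Map F A B f) (Map G A B f)"
  by (simp_all add: functor_times_def)

lemma set_functor_comp:
  assumes "set_functor F" "set_functor G"
  shows "set_functor (G \<odot> F)"
proof -
  interpret F: set_functor F by fact
  interpret G: set_functor G by fact
  show ?thesis
    by unfold_locales
      (auto simp: F.small_Ob G.small_Ob F.Map_id G.Map_id
        F.Map_compose G.Map_compose[OF F.Map_hom F.Map_hom] intro: F.Map_hom G.Map_hom)
qed

text \<open>\<open>F\<close> turns an inverse image diagram into a pullback whose distinguished leg
  is again monic by \<open>Map_monic\<close>, so \<open>G\<close> preserves it in turn.\<close>

lemma taut_functor_comp:
  assumes "taut_functor F" "taut_functor G"
  shows "taut_functor (G \<odot> F)"
proof -
  interpret F: taut_functor F by fact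
  interpret G: taut_functor G by fact
  interpret set_functor "G \<odot> F"
    by (intro set_functor_comp) unfold_locales
  show ?thesis
    by unfold_locales
      (simp add: G.preserves_inverse_images F.preserves_inverse_images F.Map_monic)
qed

lemma set_functor_times:
  assumes "set_functor F" "set_functor G"
  shows "set_functor (F \<otimes> G)"
proof -
  interpret F: set_functor F by fact
  interpret G: set_functor G by fact
  show ?thesis
  proof
    show hom: "Map (F \<otimes> G) A B f \<in> hom (Ob (F \<otimes> G) A) (Ob (F \<otimes> G) B)"
      if "f \<in> hom A B" for f A B
      using that by (auto intro: times_map_hom F.Map_hom G.Map_hom)
    show small: "small (Ob (F \<otimes> G) A)" if "small A" for A
      using that by (simp add: small_times_set F.small_Ob G.small_Ob)
    show "Map (F \<otimes> G) A A (restrict id A) = restrict id (Ob (F \<otimes> G) A)" if "small A" for A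
      using that by (intro hom_eqI[OF hom id_hom[OF small]])
        (auto simp: F.Map_id G.Map_id intro: id_hom elim!: times_cases)
    show "Map (F \<otimes> G) A C (compose A g f) =
        compose (Ob (F \<otimes> G) A) (Map (F \<otimes> G) B C g) (Map (F \<otimes> G) A B f)"
      if f: "f \<in> hom A B" and g: "g \<in> hom B C" for f g A B C
      using f g by (intro hom_eqI[OF hom[OF compose_hom[OF f g]] compose_hom[OF hom[OF f] hom[OF g]]])
        (auto simp: compose_eq F.Map_compose_apply[OF f g] G.Map_compose_apply[OF f g]
          F.Map_apply G.Map_apply elim!: times_cases)
  qed
qed

section \<open>Vertical and horizontal composites and products of transformations\<close>

lemma nat_trans_vertical_comp:
  assumes "nat_trans F G s" "nat_trans G H t"
  shows "nat_trans F H (t \<bullet> s)"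
proof -
  interpret s: nat_trans F G s by fact
  interpret t: nat_trans G H t by fact
  show ?thesis
  proof
    show "Comp (t \<bullet> s) A \<in> hom (Ob F A) (Ob H A)" if "small A" for A
      using that by (auto simp: vertical_comp_def s.Dom_eq intro: compose_hom s.Comp_hom t.Comp_hom)
    show "compose (Ob F A) (Comp (t \<bullet> s) B) (Map F A B f) =
        compose (Ob F A) (Map H A B f) (Comp (t \<bullet> s) A)" if f: "f \<in> hom A B" for f A B
      using hom_small[OF f]
      by (intro compose_eqI) (simp add: vertical_comp_def s.Dom_eq compose_eq s.dom.Map_apply[OF f]
          s.Comp_apply s.naturality_apply[OF f] t.naturality_apply[OF f])
  qed (simp_all add: vertical_comp_def s.Dom_eq t.Cod_eq)
qed

lemma horizontal_comp_apply:
  assumes "nat_trans F F' t" "nat_trans G G' u" "x \<in> Ob G (Ob F A)"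
  shows "Comp (u \<star> t) A x = Comp u (Ob F' A) (Map G (Ob F A) (Ob F' A) (Comp t A) x)"
proof -
  interpret t: nat_trans F F' t by fact
  interpret u: nat_trans G G' u by fact
  show ?thesis
    using assms(3) by (simp add: horizontal_comp_def t.Dom_eq t.Cod_eq u.Dom_eq compose_eq)
qed

lemma nat_trans_horizontal_comp:
  assumes t: "nat_trans F F' t" and u: "nat_trans G G' u"
  shows "nat_trans (G \<odot> F) (G' \<odot> F') (u \<star> t)"
proof -
  interpret t: nat_trans F F' t by fact
  interpret u: nat_trans G G' u by fact
  interpret GF: set_functor "G \<odot> F"
    by (intro set_functor_comp) unfold_locales
  interpret GF': set_functor "G' \<odot> F'"
    by (intro set_functor_comp) unfold_locales
  show ?thesis
  proof
    show "Comp (u \<star> t) A \<in> hom (Ob (G \<odot> F) A) (Ob (G' \<odot> F') A)" if "small A" for A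
      using that
      by (auto simp: horizontal_comp_def t.Dom_eq t.Cod_eq u.Dom_eq
          intro: compose_hom t.Comp_hom u.Comp_hom u.dom.Map_hom t.cod.small_Ob)
    show "compose (Ob (G \<odot> F) A) (Comp (u \<star> t) B) (Map (G \<odot> F) A B f) =
        compose (Ob (G \<odot> F) A) (Map (G' \<odot> F') A B f) (Comp (u \<star> t) A)"
      if f: "f \<in> hom A B" for f A B
    proof (rule compose_eqI)
      fix x assume "x \<in> Ob (G \<odot> F) A"
      then have x: "x \<in> Ob G (Ob F A)" by simp
      note t_hom = t.Comp_hom[OF hom_small(1)[OF f]] t.Comp_hom[OF hom_small(2)[OF f]]
      note F_hom = t.dom.Map_hom[OF f] t.cod.Map_hom[OF f]
      \<comment> \<open>\<open>G\<close> is applied to the naturality square of \<open>t\<close> at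
        \<open>f\<close>; what then remains is naturality of \<open>u\<close> at
        \<open>Map F' A B f\<close>.\<close>
      have "Map G (Ob F B) (Ob F' B) (Comp t B) (Map G (Ob F A) (Ob F B) (Map F A B f) x) =
          Map G (Ob F' A) (Ob F' B) (Map F' A B f) (Map G (Ob F A) (Ob F' A) (Comp t A) x)"
        by (rule u.dom.Map_square) (use t_hom F_hom x in \<open>auto simp: t.naturality[OF f]\<close>)
      then show "Comp (u \<star> t) B (Map (G \<odot> F) A B f x) =
          Map (G' \<odot> F') A B f (Comp (u \<star> t) A x)"
        using x by (simp add: horizontal_comp_apply[OF t u] u.dom.Map_apply[OF F_hom(1)]
            u.dom.Map_apply[OF t_hom(1)] u.naturality_apply[OF F_hom(2)])
    qed
  qed (simp_all add: horizontal_comp_def t.Dom_eq t.Cod_eq u.Dom_eq u.Cod_eq)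
qed

lemma nat_trans_times:
  assumes "nat_trans F F' s" "nat_trans G G' t"
  shows "nat_trans (F \<otimes> G) (F' \<otimes> G') (s \<boxtimes> t)"
proof -
  interpret s: nat_trans F F' s by fact
  interpret t: nat_trans G G' t by fact
  interpret FG: set_functor "F \<otimes> G"
    by (intro set_functor_times) unfold_locales
  interpret FG': set_functor "F' \<otimes> G'"
    by (intro set_functor_times) unfold_locales
  show ?thesis
  proof
    show "Comp (s \<boxtimes> t) A \<in> hom (Ob (F \<otimes> G) A) (Ob (F' \<otimes> G') A)" if "small A" for A
      using that
      by (auto simp: trans_times_def s.Dom_eq t.Dom_eq intro: times_map_hom s.Comp_hom t.Comp_hom)
    show "compose (Ob (F \<otimes> G) A) (Comp (s \<boxtimes> t) B) (Map (F \<otimes> G) A B f) =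
        compose (Ob (F \<otimes> G) A) (Map (F' \<otimes> G') A B f) (Comp (s \<boxtimes> t) A)"
      if f: "f \<in> hom A B" for f A B
      using hom_small[OF f]
      by (intro compose_eqI)
        (auto simp: trans_times_def s.Dom_eq t.Dom_eq s.dom.Map_apply[OF f] t.dom.Map_apply[OF f]
          s.Comp_apply t.Comp_apply s.naturality_apply[OF f] t.naturality_apply[OF f]
          elim!: times_cases)
  qed (simp_all add: trans_times_def s.Dom_eq t.Dom_eq s.Cod_eq t.Cod_eq)
qed

text \<open>Pasting of pullbacks: the square of \<open>u \<star> t\<close> at \<open>m\<close>
  consists of \<open>G\<close> applied to the square of \<open>t\<close> at \<open>m\<close>,
  followed by the square of \<open>u\<close> at the monomorphism \<open>F'(m)\<close>.\<close>

lemma taut_nat_trans_horizontal_comp: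
  fixes F F' G G' :: "'v::set_universe endofunctor"
  assumes "taut_functor F" "taut_functor F'" "taut_functor G"
    and "taut_nat_trans F F' t" "taut_nat_trans G G' u"
  shows "taut_nat_trans (G \<odot> F) (G' \<odot> F') (u \<star> t)"
proof -
  interpret F: taut_functor F by fact
  interpret F': taut_functor F' by fact
  interpret G: taut_functor G by fact
  interpret t: taut_nat_trans F F' t by fact
  interpret u: taut_nat_trans G G' u by fact
  note nt = t.nat_trans_axioms and nu = u.nat_trans_axioms
  interpret ut: nat_trans "G \<odot> F" "G' \<odot> F'" "u \<star> t"
    by (rule nat_trans_horizontal_comp) (rule nt nu)+
  show ?thesis
  proof
    fix A\<^sub>0 A :: "'v set" and m
    assume m: "monic A\<^sub>0 A m"
    then have hom: "m \<in> hom A\<^sub>0 A" by (simp add: monic_iff)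
    have F'm: "monic (Ob F' A\<^sub>0) (Ob F' A) (Map F' A\<^sub>0 A m)"
      by (rule F'.Map_monic[OF m])
    note pb_u = u.naturality_pullback[OF F'm]
    note pb_t = G.preserves_inverse_images[OF pullback_sym[OF t.naturality_pullback[OF m]] F'm]
    have tA: "Comp t A \<in> hom (Ob F A) (Ob F' A)"
      by (rule t.Comp_hom[OF hom_small(2)[OF hom]])
    have mono: "monic (Ob (G \<odot> F) A\<^sub>0) (Ob (G \<odot> F) A) (Map (G \<odot> F) A\<^sub>0 A m)"
      using G.Map_monic[OF F.Map_monic[OF m]] by simp
    \<comment> \<open>The transposed square is treated first, because \<open>pullback_monicI\<close>
      expects the monic leg in first position.\<close>
    have "pullback (Ob (G \<odot> F) A\<^sub>0) (Ob (G \<odot> F) A) (Ob (G' \<odot> F') A\<^sub>0) (Ob (G' \<odot> F') A)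
        (Map (G \<odot> F) A\<^sub>0 A m) (Comp (u \<star> t) A\<^sub>0) (Comp (u \<star> t) A) (Map (G' \<odot> F') A\<^sub>0 A m)"
    proof (rule pullback_monicI[OF mono])
      show "Comp (u \<star> t) A\<^sub>0 \<in> hom (Ob (G \<odot> F) A\<^sub>0) (Ob (G' \<odot> F') A\<^sub>0)"
        "Comp (u \<star> t) A \<in> hom (Ob (G \<odot> F) A) (Ob (G' \<odot> F') A)"
        by (intro ut.Comp_hom hom_small[OF hom])+
      show "Map (G' \<odot> F') A\<^sub>0 A m \<in> hom (Ob (G' \<odot> F') A\<^sub>0) (Ob (G' \<odot> F') A)"
        by (rule ut.cod.Map_hom[OF hom])
      show "Comp (u \<star> t) A (Map (G \<odot> F) A\<^sub>0 A m x) = Map (G' \<odot> F') A\<^sub>0 A m (Comp (u \<star> t) A\<^sub>0 x)"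
        if "x \<in> Ob (G \<odot> F) A\<^sub>0" for x
        by (rule ut.naturality_apply[OF hom that])
      fix b c
      assume "b \<in> Ob (G \<odot> F) A" "c \<in> Ob (G' \<odot> F') A\<^sub>0"
        and eq: "Comp (u \<star> t) A b = Map (G' \<odot> F') A\<^sub>0 A m c"
      then have b: "b \<in> Ob G (Ob F A)" and c: "c \<in> Ob G' (Ob F' A\<^sub>0)" by simp_all
      define d where "d = Map G (Ob F A) (Ob F' A) (Comp t A) b"
      have d: "d \<in> Ob G (Ob F' A)"
        unfolding d_def by (rule G.Map_apply[OF tA b])
      have "Map G' (Ob F' A\<^sub>0) (Ob F' A) (Map F' A\<^sub>0 A m) c = Comp u (Ob F' A) d"
        using eq b by (simp add: d_def horizontal_comp_apply[OF nt nu])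
      \<comment> \<open>The pair \<open>(c, d)\<close> lifts through the square of \<open>u\<close>;
        the resulting \<open>e\<close> and \<open>b\<close> then lift through \<open>G\<close> of
        the square of \<open>t\<close>.\<close>
      from pullback_lift[OF pb_u c d this] obtain e where e: "e \<in> Ob G (Ob F' A\<^sub>0)"
        "Comp u (Ob F' A\<^sub>0) e = c" "Map G (Ob F' A\<^sub>0) (Ob F' A) (Map F' A\<^sub>0 A m) e = d" .
      from pullback_lift[OF pb_t b e(1)] e(3) obtain a where a: "a \<in> Ob G (Ob F A\<^sub>0)"
        "Map G (Ob F A\<^sub>0) (Ob F A) (Map F A\<^sub>0 A m) a = b"
        "Map G (Ob F A\<^sub>0) (Ob F' A\<^sub>0) (Comp t A\<^sub>0) a = e"
        unfolding d_def by metis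
      then show "\<exists>a. a \<in> Ob (G \<odot> F) A\<^sub>0 \<and> Map (G \<odot> F) A\<^sub>0 A m a = b \<and> Comp (u \<star> t) A\<^sub>0 a = c"
        using e by (auto simp: horizontal_comp_apply[OF nt nu])
    qed
    then show "pullback (Ob (G \<odot> F) A\<^sub>0) (Ob (G' \<odot> F') A\<^sub>0) (Ob (G \<odot> F) A) (Ob (G' \<odot> F') A)
        (Comp (u \<star> t) A\<^sub>0) (Map (G \<odot> F) A\<^sub>0 A m) (Map (G' \<odot> F') A\<^sub>0 A m) (Comp (u \<star> t) A)"
      by (rule pullback_sym)
  qed
qed


section \<open>The difference operator and the chain rule transformation\<close>

lemma Ob_difference:
  "Ob (\<Delta> F) X = Ob F (plus_one X) - Map F X (plus_one X) (inj_one X) ` Ob F X"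
  by (simp add: difference_def)

lemma Map_difference_apply:
  "w \<in> Ob (\<Delta> F) X \<Longrightarrow>
    Map (\<Delta> F) X Y f w = Map F (plus_one X) (plus_one Y) (plus_one_map X f) w"
  by (simp add: difference_def)

lemma Ob_differenceD: "w \<in> Ob (\<Delta> F) X \<Longrightarrow> w \<in> Ob F (plus_one X)"
  by (simp add: difference_def)

text \<open>If the value of \<open>w\<close> were in the image, the preserved pullback would lift
  \<open>w\<close> to \<open>Ob F X\<close>, contradicting its choice outside the image of
  \<open>F(j\<^sub>X)\<close>. This serves both for the action of \<open>\<Delta> F\<close> on
  morphisms and for the values of \<open>\<gamma>\<close>.\<close>

lemma (in taut_functor) Map_notin_image:
  assumes pb: "pullback X (plus_one X) C A (inj_one X) q f m" and m: "monic C A m"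
    and w: "w \<in> Ob (\<Delta> F) X"
  shows "Map F (plus_one X) A f w \<notin> Map F C A m ` Ob F C"
proof
  assume "Map F (plus_one X) A f w \<in> Map F C A m ` Ob F C"
  then obtain c where c: "c \<in> Ob F C" "Map F (plus_one X) A f w = Map F C A m c" by auto
  from pullback_lift[OF preserves_inverse_images[OF pb m] Ob_differenceD[OF w] c] w
  show False by (auto simp: Ob_difference)
qed

lemma (in taut_functor) set_functor_difference: "set_functor (\<Delta> F)"
proof
  show small: "small (Ob (\<Delta> F) A)" if "small A" for A
    using small_subset[OF small_Ob[OF small_plus_one[OF that]]] by (auto simp: Ob_difference)
  show hom: "Map (\<Delta> F) A B f \<in> hom (Ob (\<Delta> F) A) (Ob (\<Delta> F) B)" if f: "f \<in> hom A B" for f A B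
  proof (rule homI)
    fix w assume w: "w \<in> Ob (\<Delta> F) A"
    show "Map (\<Delta> F) A B f w \<in> Ob (\<Delta> F) B"
      using Map_apply[OF plus_one_map_hom[OF f] Ob_differenceD[OF w]]
        Map_notin_image[OF pullback_inj_one[OF f] inj_one_monic[OF hom_small(2)[OF f]] w]
      unfolding Map_difference_apply[OF w] by (simp add: Ob_difference)
  qed (simp_all add: small hom_small[OF f], simp add: difference_def)
  show "Map (\<Delta> F) A A (restrict id A) = restrict id (Ob (\<Delta> F) A)" if "small A" for A
    using that by (intro hom_eqI[OF hom[OF id_hom] id_hom[OF small]])
      (auto simp: Map_difference_apply plus_one_map_id Map_id small_plus_one dest: Ob_differenceD)
  show "Map (\<Delta> F) A C (compose A g f) =
      compose (Ob (\<Delta> F) A) (Map (\<Delta> F) B C g) (Map (\<Delta> F) A B f)"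
    if f: "f \<in> hom A B" and g: "g \<in> hom B C" for f g A B C
  proof (rule hom_eqI[OF hom[OF compose_hom[OF f g]] compose_hom[OF hom[OF f] hom[OF g]]])
    fix w assume w: "w \<in> Ob (\<Delta> F) A"
    \<comment> \<open>The intermediate value must be known to lie in
      \<open>Ob (\<Delta> F) B\<close>, since the outer map is a restriction to that set.\<close>
    show "Map (\<Delta> F) A C (compose A g f) w =
        compose (Ob (\<Delta> F) A) (Map (\<Delta> F) B C g) (Map (\<Delta> F) A B f) w"
      using w hom_apply[OF hom[OF f] w]
      by (simp add: Map_difference_apply compose_eq plus_one_map_compose[OF f g]
          Map_compose_apply[OF plus_one_map_hom[OF f] plus_one_map_hom[OF g]] Ob_differenceD)
  qed
qed

section \<open>The difference of a taut transformation\<close>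

lemma difference_trans_apply:
  assumes "nat_trans F G t" "w \<in> Ob (\<Delta> F) X"
  shows "Comp (\<Delta>\<^sub>N t) X w = Comp t (plus_one X) w"
proof -
  interpret nat_trans F G t by fact
  show ?thesis
    using assms(2) by (simp add: difference_trans_def Dom_eq)
qed

lemma nat_trans_difference:
  assumes "taut_functor F" "taut_functor G" "taut_nat_trans F G t"
  shows "nat_trans (\<Delta> F) (\<Delta> G) (\<Delta>\<^sub>N t)"
proof -
  interpret F: taut_functor F by fact
  interpret G: taut_functor G by fact
  interpret t: taut_nat_trans F G t by fact
  interpret DF: set_functor "\<Delta> F" by (rule F.set_functor_difference)
  interpret DG: set_functor "\<Delta> G" by (rule G.set_functor_difference)
  note component = difference_trans_apply[OF t.nat_trans_axioms]
  show ?thesis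
  proof
    show hom: "Comp (\<Delta>\<^sub>N t) A \<in> hom (Ob (\<Delta> F) A) (Ob (\<Delta> G) A)" if A: "small A" for A
    proof (rule homI)
      fix w assume w: "w \<in> Ob (\<Delta> F) A"
      \<comment> \<open>Tautness of \<open>t\<close> enters at the monomorphism
        \<open>inj_one A\<close>: a preimage of \<open>t(A + 1)(w)\<close> under
        \<open>G(j\<^sub>A)\<close> would lift to a preimage of \<open>w\<close> under
        \<open>F(j\<^sub>A)\<close>.\<close>
      have "Comp t (plus_one A) w \<notin> Map G A (plus_one A) (inj_one A) ` Ob G A"
      proof
        assume "Comp t (plus_one A) w \<in> Map G A (plus_one A) (inj_one A) ` Ob G A"
        then obtain c where "c \<in> Ob G A"
          "Map G A (plus_one A) (inj_one A) c = Comp t (plus_one A) w" by auto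
        from pullback_lift[OF t.naturality_pullback[OF inj_one_monic[OF A]]
            this(1) Ob_differenceD[OF w] this(2)] w
        show False by (auto simp: Ob_difference)
      qed
      then show "Comp (\<Delta>\<^sub>N t) A w \<in> Ob (\<Delta> G) A"
        using t.Comp_apply[OF small_plus_one[OF A] Ob_differenceD[OF w]]
        unfolding component[OF w] by (simp add: Ob_difference)
    qed (auto intro: DF.small_Ob[OF A] DG.small_Ob[OF A] simp: difference_trans_def t.Dom_eq)
    show "compose (Ob (\<Delta> F) A) (Comp (\<Delta>\<^sub>N t) B) (Map (\<Delta> F) A B f) =
        compose (Ob (\<Delta> F) A) (Map (\<Delta> G) A B f) (Comp (\<Delta>\<^sub>N t) A)" if f: "f \<in> hom A B" for f A B
    proof (rule compose_eqI)
      fix w assume w: "w \<in> Ob (\<Delta> F) A"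
      show "Comp (\<Delta>\<^sub>N t) B (Map (\<Delta> F) A B f w) = Map (\<Delta> G) A B f (Comp (\<Delta>\<^sub>N t) A w)"
        using DF.Map_apply[OF f w] hom_apply[OF hom[OF hom_small(1)[OF f]] w]
        by (simp add: component w Map_difference_apply Ob_differenceD
            t.naturality_apply[OF plus_one_map_hom[OF f]])
    qed
  qed (simp_all add: difference_trans_def t.Dom_eq t.Cod_eq)
qed

section \<open>The maps \<open>\<phi>\<close> and naturality of the chain rule
  transformation\<close>

lemma \<phi>_hom:
  assumes "set_functor F" "small A" "x \<in> Ob F (plus_one A)"
  shows "\<phi> F A x \<in> hom (plus_one (Ob F A)) (Ob F (plus_one A))"
proof -
  interpret set_functor F by fact
  show ?thesis
    unfolding \<phi>_def using assms by (intro copair_hom Map_hom inj_one_hom)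
qed

text \<open>On \<open>F(A)\<close> this is \<open>F\<close> applied to
  \<open>(f + 1) \<cdot> j\<^sub>A = j\<^sub>B \<cdot> f\<close>. It yields naturality of
  \<open>\<gamma>\<close>.\<close>

lemma \<phi>_Map:
  assumes "set_functor F" "f \<in> hom A B"
  shows "compose (plus_one (Ob F A))
           (\<phi> F B (Map F (plus_one A) (plus_one B) (plus_one_map A f) x))
           (plus_one_map (Ob F A) (Map F A B f)) =
         compose (plus_one (Ob F A))
           (Map F (plus_one A) (plus_one B) (plus_one_map A f)) (\<phi> F A x)"
proof -
  interpret set_functor F by fact
  note f = assms(2)
  note j = inj_one_hom[OF hom_small(1)[OF f]] inj_one_hom[OF hom_small(2)[OF f]]
  show ?thesis
    unfolding \<phi>_def
    by (intro copair_plus_one_map Map_hom[OF f] Map_square[OF j(1) plus_one_map_hom[OF f] f j(2)]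
        compose_eqI) (auto simp: hom_apply[OF f])
qed

text \<open>On \<open>F(A)\<close> this is naturality of \<open>t\<close> at
  \<open>inj_one A\<close>; on the added point both sides give \<open>t(A + 1)(x)\<close>.\<close>

lemma \<phi>_Comp:
  assumes "nat_trans F F' t" "small A"
  shows "compose (plus_one (Ob F A))
           (\<phi> F' A (Comp t (plus_one A) x)) (plus_one_map (Ob F A) (Comp t A)) =
         compose (plus_one (Ob F A)) (Comp t (plus_one A)) (\<phi> F A x)"
proof -
  interpret nat_trans F F' t by fact
  show ?thesis
    unfolding \<phi>_def
    by (intro copair_plus_one_map Comp_hom naturality_apply inj_one_hom assms(2))
qed

lemma \<gamma>_apply:
  assumes "y \<in> Ob (\<Delta> G) (Ob F A)" "x \<in> Ob (\<Delta> F) A"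
  shows "Comp (\<gamma> G F) A (encode_pair (y, x)) =
    Map G (plus_one (Ob F A)) (Ob F (plus_one A)) (\<phi> F A x) y"
  using assms by (simp add: \<gamma>_def)

lemma nat_trans_\<gamma>:
  assumes "taut_functor F" "taut_functor G"
  shows "nat_trans ((\<Delta> G \<odot> F) \<otimes> \<Delta> F) (\<Delta> (G \<odot> F)) (\<gamma> G F)"
proof -
  interpret F: taut_functor F by fact
  interpret G: taut_functor G by fact
  interpret GF: taut_functor "G \<odot> F"
    by (rule taut_functor_comp) fact+
  interpret DF: set_functor "\<Delta> F" by (rule F.set_functor_difference)
  interpret DG: set_functor "\<Delta> G" by (rule G.set_functor_difference)
  interpret dom: set_functor "(\<Delta> G \<odot> F) \<otimes> \<Delta> F"
    by (intro set_functor_times set_functor_comp) unfold_locales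
  interpret cod: set_functor "\<Delta> (G \<odot> F)" by (rule GF.set_functor_difference)
  note \<phi>_hom = \<phi>_hom[OF F.set_functor_axioms]
  show ?thesis
  proof
    show hom: "Comp (\<gamma> G F) A \<in> hom (Ob ((\<Delta> G \<odot> F) \<otimes> \<Delta> F) A) (Ob (\<Delta> (G \<odot> F)) A)"
      if A: "small A" for A
    proof (rule homI)
      fix z assume "z \<in> Ob ((\<Delta> G \<odot> F) \<otimes> \<Delta> F) A"
      then obtain y x where y: "y \<in> Ob (\<Delta> G) (Ob F A)" and x: "x \<in> Ob (\<Delta> F) A"
        and z: "z = encode_pair (y, x)"
        by (auto elim!: times_cases)
      have mono: "monic (Ob F A) (Ob F (plus_one A)) (Map F A (plus_one A) (inj_one A))"
        by (rule F.Map_monic[OF inj_one_monic[OF A]])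
      have "Map G (plus_one (Ob F A)) (Ob F (plus_one A)) (\<phi> F A x) y
          \<notin> Map G (Ob F A) (Ob F (plus_one A)) (Map F A (plus_one A) (inj_one A)) ` Ob G (Ob F A)"
        \<comment> \<open>As \<open>x\<close> avoids the image of the monomorphism
          \<open>F(j\<^sub>A)\<close>, \<open>pullback_copair\<close> provides the inverse image
          that \<open>G\<close> preserves.\<close>
        unfolding \<phi>_def
        by (rule G.Map_notin_image[OF pullback_copair[OF mono] mono y])
          (use x in \<open>auto simp: Ob_difference\<close>)
      moreover have "Map G (plus_one (Ob F A)) (Ob F (plus_one A)) (\<phi> F A x) y
          \<in> Ob G (Ob F (plus_one A))"
        by (rule G.Map_apply[OF \<phi>_hom[OF A Ob_differenceD[OF x]] Ob_differenceD[OF y]])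
      ultimately show "Comp (\<gamma> G F) A z \<in> Ob (\<Delta> (G \<odot> F)) A"
        unfolding z \<gamma>_apply[where ?F = F and ?G = G, OF y x] by (simp add: Ob_difference)
    qed (use A in \<open>auto simp: dom.small_Ob[simplified] cod.small_Ob \<gamma>_def\<close>)
    show "compose (Ob ((\<Delta> G \<odot> F) \<otimes> \<Delta> F) A) (Comp (\<gamma> G F) B) (Map ((\<Delta> G \<odot> F) \<otimes> \<Delta> F) A B f) =
        compose (Ob ((\<Delta> G \<odot> F) \<otimes> \<Delta> F) A) (Map (\<Delta> (G \<odot> F)) A B f) (Comp (\<gamma> G F) A)"
      if f: "f \<in> hom A B" for f A B
    proof (rule compose_eqI)
      fix z assume z_in: "z \<in> Ob ((\<Delta> G \<odot> F) \<otimes> \<Delta> F) A"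
      then obtain y x where y: "y \<in> Ob (\<Delta> G) (Ob F A)" and x: "x \<in> Ob (\<Delta> F) A"
        and z: "z = encode_pair (y, x)"
        by (auto elim!: times_cases)
      \<comment> \<open>\<open>x'\<close> and \<open>y'\<close> are the images of \<open>x\<close>
        under \<open>\<Delta>[F](f)\<close> and of \<open>y\<close> under
        \<open>\<Delta>[G](F(f))\<close>, written without the restrictions.\<close>
      define x' where "x' = Map F (plus_one A) (plus_one B) (plus_one_map A f) x"
      define y' where "y' = Map G (plus_one (Ob F A)) (plus_one (Ob F B))
        (plus_one_map (Ob F A) (Map F A B f)) y"
      have x': "x' \<in> Ob (\<Delta> F) B"
        using DF.Map_apply[OF f x] by (simp add: x'_def Map_difference_apply[OF x])
      have y': "y' \<in> Ob (\<Delta> G) (Ob F B)"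
        using DG.Map_apply[OF F.Map_hom[OF f] y] by (simp add: y'_def Map_difference_apply[OF y])
      note \<phi>_homs = \<phi>_hom[OF hom_small(1)[OF f] Ob_differenceD[OF x]]
        \<phi>_hom[OF hom_small(2)[OF f] Ob_differenceD[OF x']]
      have "Map G (plus_one (Ob F B)) (Ob F (plus_one B)) (\<phi> F B x') y' =
          Map G (Ob F (plus_one A)) (Ob F (plus_one B))
            (Map F (plus_one A) (plus_one B) (plus_one_map A f))
            (Map G (plus_one (Ob F A)) (Ob F (plus_one A)) (\<phi> F A x) y)"
        unfolding y'_def
        by (rule G.Map_square[OF plus_one_map_hom[OF F.Map_hom[OF f]] \<phi>_homs(2) \<phi>_homs(1)
              F.Map_hom[OF plus_one_map_hom[OF f]] Ob_differenceD[OF y]])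
          (simp add: x'_def \<phi>_Map[OF F.set_functor_axioms f])
      \<comment> \<open>This membership allows the restriction in
        \<open>Map (\<Delta> (G \<odot> F))\<close> to be unfolded.\<close>
      moreover have "Comp (\<gamma> G F) A z \<in> Ob (\<Delta> (G \<odot> F)) A"
        by (rule hom_apply[OF hom[OF hom_small(1)[OF f]] z_in])
      ultimately show "Comp (\<gamma> G F) B (Map ((\<Delta> G \<odot> F) \<otimes> \<Delta> F) A B f z) =
          Map (\<Delta> (G \<odot> F)) A B f (Comp (\<gamma> G F) A z)"
        using x y x' y'
        by (simp add: z \<gamma>_apply Map_difference_apply flip: x'_def y'_def)
    qed
  qed (simp_all add: \<gamma>_def)
qed

section \<open>Compatibility of the chain rule with taut transformations\<close>

theorem theorem3p3p2:
  fixes F F' G G' :: "'v::set_universe endofunctor"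
    and t u :: "'v transformation"
  assumes "taut_functor F" and "taut_functor F'"
    and "taut_functor G" and "taut_functor G'"
    and "taut_nat_trans F F' t" and "taut_nat_trans G G' u"
  shows "nat_trans_eq ((\<Delta> G \<odot> F) \<otimes> \<Delta> F) (\<Delta> (G' \<odot> F'))
           (\<Delta>\<^sub>N (u \<star> t) \<bullet> \<gamma> G F)
           (\<gamma> G' F' \<bullet> ((\<Delta>\<^sub>N u \<star> t) \<boxtimes> \<Delta>\<^sub>N t))"
proof -
  interpret F: taut_functor F by fact
  interpret G: taut_functor G by fact
  interpret t: taut_nat_trans F F' t by fact
  interpret u: taut_nat_trans G G' u by fact
  note nt = t.nat_trans_axioms and nu = u.nat_trans_axioms
  \<comment> \<open>Tautness of \<open>u \<star> t\<close> is what
    \<open>nat_trans_difference\<close> requires to make its difference a natural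
    transformation.\<close>
  have taut_ut: "taut_nat_trans (G \<odot> F) (G' \<odot> F') (u \<star> t)"
    by (rule taut_nat_trans_horizontal_comp) fact+
  then have nut: "nat_trans (G \<odot> F) (G' \<odot> F') (u \<star> t)"
    by (rule taut_nat_trans.axioms)
  interpret Dut: nat_trans "\<Delta> (G \<odot> F)" "\<Delta> (G' \<odot> F')" "\<Delta>\<^sub>N (u \<star> t)"
    by (intro nat_trans_difference taut_functor_comp assms taut_ut)
  interpret Dt: nat_trans "\<Delta> F" "\<Delta> F'" "\<Delta>\<^sub>N t"
    by (intro nat_trans_difference assms)
  interpret Du: nat_trans "\<Delta> G" "\<Delta> G'" "\<Delta>\<^sub>N u"
    by (intro nat_trans_difference assms)
  interpret Du_t: nat_trans "\<Delta> G \<odot> F" "\<Delta> G' \<odot> F'" "\<Delta>\<^sub>N u \<star> t"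
    by (intro nat_trans_horizontal_comp) unfold_locales
  interpret prod: nat_trans "(\<Delta> G \<odot> F) \<otimes> \<Delta> F" "(\<Delta> G' \<odot> F') \<otimes> \<Delta> F'" "(\<Delta>\<^sub>N u \<star> t) \<boxtimes> \<Delta>\<^sub>N t"
    by (intro nat_trans_times) unfold_locales
  interpret \<gamma>: nat_trans "(\<Delta> G \<odot> F) \<otimes> \<Delta> F" "\<Delta> (G \<odot> F)" "\<gamma> G F"
    by (intro nat_trans_\<gamma> assms)
  interpret \<gamma>': nat_trans "(\<Delta> G' \<odot> F') \<otimes> \<Delta> F'" "\<Delta> (G' \<odot> F')" "\<gamma> G' F'"
    by (intro nat_trans_\<gamma> assms)
  have "Comp (\<Delta>\<^sub>N (u \<star> t) \<bullet> \<gamma> G F) A = Comp (\<gamma> G' F' \<bullet> ((\<Delta>\<^sub>N u \<star> t) \<boxtimes> \<Delta>\<^sub>N t)) A"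
    if A: "small A" for A
    unfolding vertical_comp_def \<gamma>.Dom_eq prod.Dom_eq select_convs
  proof (rule compose_eqI)
    fix z assume z_in: "z \<in> Ob ((\<Delta> G \<odot> F) \<otimes> \<Delta> F) A"
    then obtain y x where y: "y \<in> Ob (\<Delta> G) (Ob F A)" and x: "x \<in> Ob (\<Delta> F) A"
      and z: "z = encode_pair (y, x)"
      by (auto elim!: times_cases)
    define x' where "x' = Comp t (plus_one A) x"
    \<comment> \<open>\<open>y\<^sub>1\<close> is the intermediate value
      \<open>\<Delta>[G](t(A))(y)\<close>, to which \<open>\<Delta>[u]\<close> at
      \<open>F'(A)\<close> is then applied to give \<open>y'\<close>.\<close>
    define y\<^sub>1 where "y\<^sub>1 = Map G (plus_one (Ob F A)) (plus_one (Ob F' A))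
      (plus_one_map (Ob F A) (Comp t A)) y"
    define y' where "y' = Comp u (plus_one (Ob F' A)) y\<^sub>1"
    note tA = t.Comp_hom[OF A] and tA1 = t.Comp_hom[OF small_plus_one[OF A]]
    have x': "x' \<in> Ob (\<Delta> F') A"
      using Dt.Comp_apply[OF A x] by (simp add: x'_def difference_trans_apply[OF nt x])
    have y\<^sub>1: "y\<^sub>1 \<in> Ob (\<Delta> G) (Ob F' A)"
      using Du.dom.Map_apply[OF tA y] by (simp add: y\<^sub>1_def Map_difference_apply[OF y])
    have y': "y' \<in> Ob (\<Delta> G') (Ob F' A)"
      using Du.Comp_apply[OF t.cod.small_Ob[OF A] y\<^sub>1]
      by (simp add: y'_def difference_trans_apply[OF nu y\<^sub>1])
    have star: "Comp (\<Delta>\<^sub>N u \<star> t) A y = y'"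
      using y y\<^sub>1
      by (simp add: horizontal_comp_apply[OF nt Du.nat_trans_axioms] Map_difference_apply
          difference_trans_apply[OF nu] y'_def flip: y\<^sub>1_def)
    have box: "Comp ((\<Delta>\<^sub>N u \<star> t) \<boxtimes> \<Delta>\<^sub>N t) A z = encode_pair (y', x')"
      using x y by (simp add: z trans_times_def Du_t.Dom_eq Dt.Dom_eq star
          difference_trans_apply[OF nt] x'_def)
    note \<phi>_homs = \<phi>_hom[OF F.set_functor_axioms A Ob_differenceD[OF x]]
      \<phi>_hom[OF t.cod.set_functor_axioms A Ob_differenceD[OF x']]
    \<comment> \<open>Two memberships are needed: this one to unfold the restriction in
      \<open>\<Delta>\<^sub>N (u \<star> t)\<close>, the weaker \<open>\<gamma>_in'\<close> to
      evaluate the component of \<open>u \<star> t\<close> at \<open>A + 1\<close>.\<close>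
    have \<gamma>_in: "Comp (\<gamma> G F) A z \<in> Ob (\<Delta> (G \<odot> F)) A"
      by (rule \<gamma>.Comp_apply[OF A z_in])
    then have \<gamma>_in': "Comp (\<gamma> G F) A z \<in> Ob G (Ob F (plus_one A))"
      by (auto dest: Ob_differenceD)
    have "Comp (\<Delta>\<^sub>N (u \<star> t)) A (Comp (\<gamma> G F) A z) =
        Comp u (Ob F' (plus_one A)) (Map G (Ob F (plus_one A)) (Ob F' (plus_one A))
          (Comp t (plus_one A)) (Comp (\<gamma> G F) A z))"
      by (simp add: difference_trans_apply[OF nut \<gamma>_in] horizontal_comp_apply[OF nt nu \<gamma>_in'])
    \<comment> \<open>\<open>G\<close> is applied to the square \<open>\<phi>_Comp\<close> at
      \<open>y\<close>, which moves \<open>t\<close> from the outside of \<open>\<phi>\<close> to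
      its inside.\<close>
    also have "Map G (Ob F (plus_one A)) (Ob F' (plus_one A)) (Comp t (plus_one A))
          (Comp (\<gamma> G F) A z) =
        Map G (plus_one (Ob F' A)) (Ob F' (plus_one A)) (\<phi> F' A x') y\<^sub>1"
      unfolding z \<gamma>_apply[where ?F = F and ?G = G, OF y x] y\<^sub>1_def
      by (rule G.Map_square[OF \<phi>_homs(1) tA1 plus_one_map_hom[OF tA] \<phi>_homs(2) Ob_differenceD[OF y]])
        (simp add: x'_def \<phi>_Comp[OF nt A])
    also have "Comp u (Ob F' (plus_one A)) \<dots> =
        Map G' (plus_one (Ob F' A)) (Ob F' (plus_one A)) (\<phi> F' A x') y'"
      unfolding y'_def by (rule u.naturality_apply[OF \<phi>_homs(2) Ob_differenceD[OF y\<^sub>1]])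
    also have "\<dots> = Comp (\<gamma> G' F') A (Comp ((\<Delta>\<^sub>N u \<star> t) \<boxtimes> \<Delta>\<^sub>N t) A z)"
      by (simp add: box \<gamma>_apply[OF y' x'])
    finally show "Comp (\<Delta>\<^sub>N (u \<star> t)) A (Comp (\<gamma> G F) A z) =
        Comp (\<gamma> G' F') A (Comp ((\<Delta>\<^sub>N u \<star> t) \<boxtimes> \<Delta>\<^sub>N t) A z)" .
  qed
  then show ?thesis
    unfolding nat_trans_eq_def
    by (intro conjI allI impI nat_trans_vertical_comp[OF \<gamma>.nat_trans_axioms Dut.nat_trans_axioms]
        nat_trans_vertical_comp[OF prod.nat_trans_axioms \<gamma>'.nat_trans_axioms]) simp
qed

end
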